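(* The class $\mathcal{L}$ of all layered permutations is not composable.
   Context: A permutation of order $n$ is a bijection $\pi:[n]\to[n]$, where $[n]=\{1,\dots,n\}$, also viewed as the sequence $\pi(1),\dots,\pi(n)$; the empty permutation is allowed. A permutation $\pi$ is contained in $\sigma$ if $\sigma$ has a (not necessarily contiguous) subsequence in the same relative order as $\pi$. A permutation class is a set of permutations closed downwards under containment. For permutations of the same order, $(\pi\circ\sigma)(i)=\pi(\sigma(i))$. For permutation classes, $\mathcal{A}\circ\mathcal{B}=\{\pi\circ\varphi : \pi\in\mathcal{A},\varphi\in\mathcal{B},|\pi|=|\varphi|\}$; this is an associative operation on permutation classes. A class $\mathcal{C}$ is $k$-composable if there are permutation classes $\mathcal{C}_1,\dots,\mathcal{C}_k\subsetneq\mathcal{C}$ (repetitions allowed) with $\mathcal{C}\subseteq\mathcal{C}_1\circ\cdots\circ\mathcal{C}_k$; it is composable if it is $k$-composable for some $k\ge2$. The sum $\pi\oplus\sigma$ of $\pi$ of order $k$ and $\sigma$ of order $l$ is the permutation $\pi(1),\dots,\pi(k),\sigma(1)+k,\dots,\sigma(l)+k$. A permutation is layered if it is a sum of (any finite number of) decreasing permutations $n,n-1,\dots,1$. *)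

theory Defs
  imports Main "HOL-Library.Sublist"
begin

text \<open>A permutation \<open>\<pi>\<close> of order \<open>n\<close> is represented by its one-line notation, the list
  \<open>[\<pi>(1), \<dots>, \<pi>(n)]\<close>. Values are 1-based as usual, but list positions are 0-based, so
  \<open>\<pi>(i)\<close> is \<open>\<pi> ! (i - 1)\<close>.\<close>

definition is_perm :: "nat list \<Rightarrow> bool" where
  "is_perm \<pi> \<longleftrightarrow> distinct \<pi> \<and> set \<pi> = {1..length \<pi>}"

definition same_relative_order :: "nat list \<Rightarrow> nat list \<Rightarrow> bool" where
  "same_relative_order xs ys \<longleftrightarrow> length xs = length ys \<and>
     (\<forall>i < length xs. \<forall>j < length xs. xs ! i < xs ! j \<longleftrightarrow> ys ! i < ys ! j)"

definition contained_in :: "nat list \<Rightarrow> nat list \<Rightarrow> bool" where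
  "contained_in \<pi> \<sigma> \<longleftrightarrow> (\<exists>\<tau>. subseq \<tau> \<sigma> \<and> same_relative_order \<pi> \<tau>)"

definition perm_class :: "nat list set \<Rightarrow> bool" where
  "perm_class C \<longleftrightarrow> (\<forall>\<pi> \<in> C. is_perm \<pi>) \<and>
     (\<forall>\<sigma> \<in> C. \<forall>\<pi>. is_perm \<pi> \<and> contained_in \<pi> \<sigma> \<longrightarrow> \<pi> \<in> C)"

text \<open>The \<open>i\<close>-th entry of the composition is \<open>\<pi>(\<sigma>(i))\<close>; it is only meaningful for two
  permutations of the same order.\<close>

definition perm_comp :: "nat list \<Rightarrow> nat list \<Rightarrow> nat list" where
  "perm_comp \<pi> \<sigma> = map (\<lambda>s. \<pi> ! (s - 1)) \<sigma>"

definition class_comp :: "nat list set \<Rightarrow> nat list set \<Rightarrow> nat list set" where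
  "class_comp A B = {perm_comp \<pi> \<phi> | \<pi> \<phi>. \<pi> \<in> A \<and> \<phi> \<in> B \<and> length \<pi> = length \<phi>}"

text \<open>Since \<^const>\<open>class_comp\<close> is associative on permutation classes, the bracketing is immaterial.
  The value for the empty list (the neutral element) is a convention that is not used for
  \<open>k \<ge> 2\<close>.\<close>

fun classes_comp :: "nat list set list \<Rightarrow> nat list set" where
  "classes_comp [] = {[1..<Suc n] | n. True}"
| "classes_comp [A] = A"
| "classes_comp (A # B # Cs) = class_comp A (classes_comp (B # Cs))"

definition k_composable :: "nat \<Rightarrow> nat list set \<Rightarrow> bool" where
  "k_composable k C \<longleftrightarrow>
     (\<exists>Cs. length Cs = k \<and> (\<forall>D \<in> set Cs. perm_class D \<and> D \<subset> C) \<and> C \<subseteq> classes_comp Cs)"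

definition composable :: "nat list set \<Rightarrow> bool" where
  "composable C \<longleftrightarrow> (\<exists>k \<ge> 2. k_composable k C)"

definition perm_sum :: "nat list \<Rightarrow> nat list \<Rightarrow> nat list" where
  "perm_sum \<pi> \<sigma> = \<pi> @ map (\<lambda>s. s + length \<pi>) \<sigma>"

definition decreasing_perm :: "nat \<Rightarrow> nat list" where
  "decreasing_perm n = rev [1..<Suc n]"

definition layered :: "nat list \<Rightarrow> bool" where
  "layered \<pi> \<longleftrightarrow> (\<exists>ns. \<pi> = foldr perm_sum (map decreasing_perm ns) [])"

definition layered_class :: "nat list set" where
  "layered_class = {\<pi>. layered \<pi>}"

end

theory Submission
  imports Defs
begin

text \<open>Call a position of a permutation a \<open>d\<close>-jump if its entry differs from the next one by more
  than \<open>d\<close>. A proper subclass of the layered permutations avoids some layered permutation, so for a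
  suitable \<open>m\<close> its members have boundedly many layers of size at least \<open>m\<close>; a \<open>2m\<close>-jump occurs only
  at an end of such a layer, so the number of \<open>2m\<close>-jumps is bounded on the subclass. Having, for some
  \<open>d\<close>, a bounded number of \<open>d\<close>-jumps is inherited by compositions: where \<open>\<phi>\<close> has no \<open>d\<close>-jump,
  a \<open>d * e\<close>-jump of \<open>\<pi> \<circ> \<phi>\<close> forces an \<open>e\<close>-jump of \<open>\<pi>\<close> within distance \<open>d\<close> of the current value
  of \<open>\<phi>\<close>. But sums of many equal large decreasing permutations have arbitrarily many arbitrarily
  large jumps.\<close>

section \<open>Jumps of a sequence\<close>

definition jumps :: "nat \<Rightarrow> nat list \<Rightarrow> nat set" where
  "jumps d xs = {j. Suc j < length xs \<and> (xs ! j + d < xs ! Suc j \<or> xs ! Suc j + d < xs ! j)}"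

text \<open>The threshold \<open>d\<close> may depend on the class, because composition multiplies
  thresholds; the pair \<open>d\<close>, \<open>b\<close> must be uniform over the class.\<close>

definition few_jumps :: "nat list set \<Rightarrow> bool" where
  "few_jumps C \<longleftrightarrow> (\<exists>d b. \<forall>\<pi> \<in> C. card (jumps d \<pi>) \<le> b)"

abbreviation layers :: "nat list \<Rightarrow> nat list" where
  "layers ns \<equiv> foldr perm_sum (map decreasing_perm ns) []"

lemma finite_jumps [simp]: "finite (jumps d xs)"
  by (rule finite_subset[of _ "{..<length xs}"]) (auto simp: jumps_def)

text \<open>Each step that is not a \<open>d\<close>-jump changes the entry by at most
  \<open>d\<close>, so \<open>q - p\<close> such steps change it by at most
  \<open>(q - p) * d\<close>.\<close>

lemma jump_between:
  assumes "p \<le> q" "q < length xs"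
    and "xs ! p + (q - p) * d < xs ! q \<or> xs ! q + (q - p) * d < xs ! p"
  shows "\<exists>l \<in> jumps d xs. p \<le> l \<and> l < q"
  using assms
proof (induction q rule: dec_induct)
  case base
  then show ?case by simp
next
  case (step q)
  show ?case
  proof (cases "q \<in> jumps d xs")
    case True
    with step.hyps show ?thesis by auto
  next
    case False
    have "(Suc q - p) * d = (q - p) * d + d"
      using step.hyps by (simp add: Suc_diff_le)
    with False step.prems
    have "xs ! p + (q - p) * d < xs ! q \<or> xs ! q + (q - p) * d < xs ! p"
      by (auto simp: jumps_def)
    with step show ?thesis by (meson Suc_lessD less_SucI)
  qed
qed

text \<open>Version of \<open>jump_between\<close> for two positions in either order. It is applied
  to positions given by consecutive values of \<phi>, which may rise or fall.\<close>

lemma jump_near: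
  assumes "p < length xs" "q < length xs" "p \<le> q + e" "q \<le> p + e"
    and "xs ! p + e * d < xs ! q \<or> xs ! q + e * d < xs ! p"
  shows "\<exists>l \<in> jumps d xs. l \<le> p + e \<and> p \<le> l + e"
proof (cases "p \<le> q")
  case True
  have "(q - p) * d \<le> e * d" using assms(4) by (intro mult_le_mono1) linarith
  with assms(5) have "xs ! p + (q - p) * d < xs ! q \<or> xs ! q + (q - p) * d < xs ! p" by linarith
  from jump_between[OF True assms(2) this] obtain l where "l \<in> jumps d xs" "p \<le> l" "l < q"
    by blast
  with assms(4) show ?thesis by (intro bexI[of _ l]) auto
next
  case False
  have "(p - q) * d \<le> e * d" using assms(3) by (intro mult_le_mono1) linarith
  with assms(5) have "xs ! q + (p - q) * d < xs ! p \<or> xs ! p + (p - q) * d < xs ! q" by linarith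
  from jump_between[OF _ assms(1) this] False
  obtain l where "l \<in> jumps d xs" "q \<le> l" "l < p"
    by auto
  with assms(3) show ?thesis by (intro bexI[of _ l]) auto
qed

section \<open>Jumps under composition\<close>

lemma is_perm_comp:
  assumes "is_perm \<pi>" "is_perm \<phi>" "length \<pi> = length \<phi>"
  shows "is_perm (perm_comp \<pi> \<phi>)"
proof -
  let ?n = "length \<pi>"
  have "(\<lambda>s. \<pi> ! (s - 1)) ` {1..?n} = (\<lambda>i. \<pi> ! i) ` {0..<?n}"
    unfolding image_Suc_atLeastLessThan[symmetric] One_nat_def
      atLeastLessThanSuc_atLeastAtMost[symmetric] image_image by simp
  then have "(\<lambda>s. \<pi> ! (s - 1)) ` {1..?n} = set \<pi>"
    by (auto simp: in_set_conv_nth)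
  moreover have "inj_on (\<lambda>s. \<pi> ! (s - 1)) {1..?n}"
    using assms(1) by (auto simp: inj_on_def is_perm_def nth_eq_iff_index_eq)
  ultimately show ?thesis
    using assms by (simp add: is_perm_def perm_comp_def distinct_map)
qed

lemma card_jumps_comp:
  assumes "is_perm \<phi>" "length \<pi> = length \<phi>"
  shows "card (jumps (d * e) (perm_comp \<pi> \<phi>))
    \<le> card (jumps d \<phi>) + card (jumps e \<pi>) * (2 * d + 1)"
proof -
  \<comment> \<open>List index \<open>l\<close> of \<pi> belongs to the argument
    \<open>Suc l\<close>, so \<open>near l\<close> collects the positions that \<phi> sends within
    distance \<open>d\<close> of that argument. As \<phi> is injective, there are at most
    \<open>2 * d + 1\<close> of them.\<close>
  define near where "near l = {j. j < length \<phi> \<and> \<phi> ! j \<in> {Suc l - d..Suc l + d}}" for l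
  have fin: "finite (near l)" for l
    by (rule finite_subset[of _ "{..<length \<phi>}"]) (auto simp: near_def)
  have "card (near l) \<le> card {Suc l - d..Suc l + d}" for l
    using assms(1)
    by (intro card_inj_on_le[of "(!) \<phi>"]) (auto simp: near_def inj_on_def is_perm_def nth_eq_iff_index_eq)
  then have near: "card (near l) \<le> 2 * d + 1" for l
    by (rule order_trans) auto
  have "jumps (d * e) (perm_comp \<pi> \<phi>) \<subseteq> jumps d \<phi> \<union> (\<Union>l \<in> jumps e \<pi>. near l)"
  proof
    fix j assume j: "j \<in> jumps (d * e) (perm_comp \<pi> \<phi>)"
    then have len: "Suc j < length \<phi>" by (simp add: jumps_def perm_comp_def)
    then have "\<phi> ! j \<in> set \<phi>" "\<phi> ! Suc j \<in> set \<phi>" by auto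
    then have range: "1 \<le> \<phi> ! j" "\<phi> ! j \<le> length \<pi>" "1 \<le> \<phi> ! Suc j" "\<phi> ! Suc j \<le> length \<pi>"
      using assms by (auto simp: is_perm_def)
    show "j \<in> jumps d \<phi> \<union> (\<Union>l \<in> jumps e \<pi>. near l)"
    proof (cases "j \<in> jumps d \<phi>")
      case False
      \<comment> \<open>Without a \<open>d\<close>-jump of \<phi> at \<open>j\<close>, \<pi> is read
        at two indices at most \<open>d\<close> apart, yet its entries there differ by more than
        \<open>d * e\<close>.\<close>
      have "\<exists>l \<in> jumps e \<pi>. l \<le> (\<phi> ! j - 1) + d \<and> \<phi> ! j - 1 \<le> l + d"
      proof (rule jump_near[where q = "\<phi> ! Suc j - 1"])
        show "\<phi> ! j - 1 < length \<pi>" "\<phi> ! Suc j - 1 < length \<pi>" using range by linarith+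
        show "\<phi> ! j - 1 \<le> \<phi> ! Suc j - 1 + d" "\<phi> ! Suc j - 1 \<le> \<phi> ! j - 1 + d"
          using False len range by (auto simp: jumps_def)
      qed (use j len in \<open>auto simp: jumps_def perm_comp_def\<close>)
      then obtain l where l: "l \<in> jumps e \<pi>" "l \<le> (\<phi> ! j - 1) + d" "\<phi> ! j - 1 \<le> l + d"
        by blast
      then have "j \<in> near l" using len range by (auto simp: near_def)
      with l(1) show ?thesis by blast
    qed simp
  qed
  then have "card (jumps (d * e) (perm_comp \<pi> \<phi>)) \<le> card (jumps d \<phi> \<union> (\<Union>l \<in> jumps e \<pi>. near l))"
    by (intro card_mono) (auto simp: fin)
  also have "\<dots> \<le> card (jumps d \<phi>) + card (\<Union>l \<in> jumps e \<pi>. near l)"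
    by (rule card_Un_le)
  also have "card (\<Union>l \<in> jumps e \<pi>. near l) \<le> (\<Sum>l \<in> jumps e \<pi>. card (near l))"
    by (rule card_UN_le) simp
  also have "\<dots> \<le> card (jumps e \<pi>) * (2 * d + 1)"
    using sum_bounded_above[of "jumps e \<pi>" "\<lambda>l. card (near l)" "2 * d + 1"] near by simp
  finally show ?thesis by simp
qed

lemma few_jumps_class_comp:
  assumes "few_jumps A" "few_jumps B" "\<forall>\<phi> \<in> B. is_perm \<phi>"
  shows "few_jumps (class_comp A B)"
proof -
  obtain e a where A: "\<And>\<pi>. \<pi> \<in> A \<Longrightarrow> card (jumps e \<pi>) \<le> a"
    using assms(1) by (auto simp: few_jumps_def)
  obtain d b where B: "\<And>\<phi>. \<phi> \<in> B \<Longrightarrow> card (jumps d \<phi>) \<le> b"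
    using assms(2) by (auto simp: few_jumps_def)
  have "card (jumps (d * e) \<sigma>) \<le> b + a * (2 * d + 1)" if "\<sigma> \<in> class_comp A B" for \<sigma>
  proof -
    from that obtain \<pi> \<phi> where "\<sigma> = perm_comp \<pi> \<phi>" "\<pi> \<in> A" "\<phi> \<in> B" "length \<pi> = length \<phi>"
      by (auto simp: class_comp_def)
    with assms(3) have "card (jumps (d * e) \<sigma>) \<le> card (jumps d \<phi>) + card (jumps e \<pi>) * (2 * d + 1)"
      using card_jumps_comp by blast
    also have "\<dots> \<le> b + a * (2 * d + 1)"
      using A[OF \<open>\<pi> \<in> A\<close>] B[OF \<open>\<phi> \<in> B\<close>] by (intro add_mono mult_le_mono1)
    finally show ?thesis .
  qed
  then show ?thesis unfolding few_jumps_def by blast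
qed

text \<open>Being a permutation is carried through the induction because
  \<open>few_jumps_class_comp\<close> requires it of the right factor, which is itself a composition
  here.\<close>

lemma few_jumps_classes_comp:
  assumes "Cs \<noteq> []" "\<forall>C \<in> set Cs. few_jumps C \<and> (\<forall>\<pi> \<in> C. is_perm \<pi>)"
  shows "few_jumps (classes_comp Cs) \<and> (\<forall>\<pi> \<in> classes_comp Cs. is_perm \<pi>)"
  using assms
proof (induction Cs rule: classes_comp.induct)
  case (3 A B Cs)
  from 3(3) have IH: "few_jumps (classes_comp (B # Cs))"
      "\<forall>\<pi> \<in> classes_comp (B # Cs). is_perm \<pi>"
    using 3(1) by (metis list.distinct(1) list.set_intros(2))+
  have "\<forall>\<pi> \<in> class_comp A (classes_comp (B # Cs)). is_perm \<pi>"
    using 3(3) IH(2) by (auto simp: class_comp_def intro: is_perm_comp)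
  with few_jumps_class_comp[OF _ IH] 3(3) show ?case by simp
qed simp_all

section \<open>Containment between layered permutations\<close>

lemma length_decreasing_perm [simp]: "length (decreasing_perm n) = n"
  by (simp add: decreasing_perm_def)

lemma nth_decreasing_perm [simp]: "j < n \<Longrightarrow> decreasing_perm n ! j = n - j"
  by (simp add: decreasing_perm_def rev_nth del: upt_Suc)

lemma is_perm_decreasing_perm: "is_perm (decreasing_perm n)"
  by (auto simp: is_perm_def decreasing_perm_def)

lemma is_perm_sum:
  assumes "is_perm \<pi>" "is_perm \<sigma>"
  shows "is_perm (perm_sum \<pi> \<sigma>)"
proof -
  have "(\<lambda>s. s + length \<pi>) ` {1..length \<sigma>} = {1 + length \<pi>..length \<sigma> + length \<pi>}"
    by (rule image_add_atLeastAtMost')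
  with assms show ?thesis
    by (auto simp: is_perm_def perm_sum_def distinct_map inj_on_def)
qed

lemma is_perm_layers: "is_perm (layers ns)"
proof (induction ns)
  case (Cons n ns)
  then show ?case by (simp add: is_perm_sum is_perm_decreasing_perm)
qed (simp add: is_perm_def)

lemma same_relative_order_append:
  assumes "same_relative_order xs xs'" "same_relative_order ys ys'"
    and "\<forall>x \<in> set xs. \<forall>y \<in> set ys. x < y" "\<forall>x \<in> set xs'. \<forall>y \<in> set ys'. x < y"
  shows "same_relative_order (xs @ ys) (xs' @ ys')"
  unfolding same_relative_order_def
proof (intro conjI allI impI)
  show "length (xs @ ys) = length (xs' @ ys')"
    using assms by (simp add: same_relative_order_def)
next
  fix i j assume ij: "i < length (xs @ ys)" "j < length (xs @ ys)"
  have len: "length xs = length xs'" "length ys = length ys'"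
    using assms(1,2) by (simp_all add: same_relative_order_def)
  have lt: "xs ! p < ys ! q" "xs' ! p < ys' ! q" "\<not> ys ! q < xs ! p" "\<not> ys' ! q < xs' ! p"
    if "p < length xs" "q < length ys" for p q
    using that assms(3,4) len by (simp_all add: not_less less_imp_le)
  show "((xs @ ys) ! i < (xs @ ys) ! j) = ((xs' @ ys') ! i < (xs' @ ys') ! j)"
    using ij assms(1,2) len lt[of i "j - length xs"] lt[of j "i - length xs"]
    by (auto simp: nth_append same_relative_order_def)
qed

lemma contained_in_perm_sum:
  assumes "contained_in \<pi>\<^sub>1 \<sigma>\<^sub>1" "contained_in \<pi>\<^sub>2 \<sigma>\<^sub>2"
    and "is_perm \<pi>\<^sub>1" "is_perm \<pi>\<^sub>2" "is_perm \<sigma>\<^sub>1" "is_perm \<sigma>\<^sub>2"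
  shows "contained_in (perm_sum \<pi>\<^sub>1 \<pi>\<^sub>2) (perm_sum \<sigma>\<^sub>1 \<sigma>\<^sub>2)"
proof -
  obtain \<tau>\<^sub>1 \<tau>\<^sub>2 where sub: "subseq \<tau>\<^sub>1 \<sigma>\<^sub>1" "subseq \<tau>\<^sub>2 \<sigma>\<^sub>2"
    and ord: "same_relative_order \<pi>\<^sub>1 \<tau>\<^sub>1" "same_relative_order \<pi>\<^sub>2 \<tau>\<^sub>2"
    using assms(1,2) by (auto simp: contained_in_def)
  have less_shift: "x < y + length \<rho>\<^sub>1"
    if "is_perm \<rho>\<^sub>1" "is_perm \<rho>\<^sub>2" "x \<in> set \<rho>\<^sub>1" "y \<in> set \<rho>\<^sub>2" for \<rho>\<^sub>1 \<rho>\<^sub>2 x y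
  proof -
    have "x \<le> length \<rho>\<^sub>1" "0 < y" using that by (auto simp: is_perm_def)
    then show ?thesis by linarith
  qed
  have \<tau>: "set \<tau>\<^sub>1 \<subseteq> set \<sigma>\<^sub>1" "set \<tau>\<^sub>2 \<subseteq> set \<sigma>\<^sub>2"
    using sub by (auto dest: list_emb_set)
  have "subseq (\<tau>\<^sub>1 @ map (\<lambda>s. s + length \<sigma>\<^sub>1) \<tau>\<^sub>2) (perm_sum \<sigma>\<^sub>1 \<sigma>\<^sub>2)"
    unfolding perm_sum_def by (intro list_emb_append_mono sub subseq_map)
  moreover have "same_relative_order (perm_sum \<pi>\<^sub>1 \<pi>\<^sub>2) (\<tau>\<^sub>1 @ map (\<lambda>s. s + length \<sigma>\<^sub>1) \<tau>\<^sub>2)"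
    unfolding perm_sum_def
  proof (rule same_relative_order_append[OF ord(1)])
    show "same_relative_order (map (\<lambda>s. s + length \<pi>\<^sub>1) \<pi>\<^sub>2) (map (\<lambda>s. s + length \<sigma>\<^sub>1) \<tau>\<^sub>2)"
      using ord(2) by (simp add: same_relative_order_def)
    show "\<forall>x \<in> set \<pi>\<^sub>1. \<forall>y \<in> set (map (\<lambda>s. s + length \<pi>\<^sub>1) \<pi>\<^sub>2). x < y"
      using less_shift[OF assms(3,4)] by simp
    show "\<forall>x \<in> set \<tau>\<^sub>1. \<forall>y \<in> set (map (\<lambda>s. s + length \<sigma>\<^sub>1) \<tau>\<^sub>2). x < y"
      using less_shift[OF assms(5,6)] \<tau> by (simp add: subset_iff)
  qed
  ultimately show ?thesis unfolding contained_in_def by blast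
qed

lemma contained_in_decreasing_perm:
  assumes "a \<le> b"
  shows "contained_in (decreasing_perm a) (decreasing_perm b)"
proof -
  \<comment> \<open>After reversal, the shorter decreasing permutation is a suffix of the longer
    one.\<close>
  have "[1..<Suc b] = [1..<Suc a] @ [Suc a..<Suc b]"
    using assms upt_add_eq_append[of 1 "Suc a" "b - a"] by simp
  then have "subseq (decreasing_perm a) (decreasing_perm b)"
    unfolding decreasing_perm_def by (simp only: rev_append list_emb_append2 subseq_order.refl)
  then show ?thesis by (auto simp: contained_in_def same_relative_order_def)
qed

text \<open>Deleting entries can shrink a layer or remove it altogether; these are the two ways in
  which \<open>list_emb\<close> proceeds.\<close>

lemma contained_in_layers:
  "list_emb (\<le>) ns ms \<Longrightarrow> contained_in (layers ns) (layers ms)"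
proof (induction rule: list_emb.induct)
  case (list_emb_Nil ms)
  show ?case by (auto simp: contained_in_def same_relative_order_def)
next
  case (list_emb_Cons ns ms m)
  \<comment> \<open>A skipped layer is matched with the empty permutation, which is neutral for
    \<open>perm_sum\<close>.\<close>
  have "contained_in (perm_sum [] (layers ns)) (perm_sum (decreasing_perm m) (layers ms))"
    using list_emb_Cons
    by (intro contained_in_perm_sum is_perm_layers is_perm_decreasing_perm)
      (auto simp: contained_in_def same_relative_order_def is_perm_def)
  then show ?case by (simp add: perm_sum_def[of "[]"])
next
  case (list_emb_Cons2 n m ns ms)
  then show ?case
    by (simp add: contained_in_perm_sum is_perm_layers is_perm_decreasing_perm
        contained_in_decreasing_perm)
qed

text \<open>Greedy matching: each entry of \<open>ns\<close> takes the next entry of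
  \<open>ms\<close> that is at least \<open>m\<close>.\<close>

lemma list_emb_of_many_large:
  fixes m :: "'a :: preorder"
  assumes "length ns \<le> length (filter (\<lambda>b. m \<le> b) ms)" "\<forall>a \<in> set ns. a \<le> m"
  shows "list_emb (\<le>) ns ms"
  using assms
proof (induction ms arbitrary: ns)
  case (Cons b ms)
  show ?case
  proof (cases ns)
    case (Cons a ns')
    show ?thesis
    proof (cases "m \<le> b")
      case True
      with Cons Cons.prems have "list_emb (\<le>) ns' ms" by (auto intro: Cons.IH)
      moreover have "a \<le> b" using True Cons Cons.prems(2) by (auto intro: order_trans)
      ultimately show ?thesis using Cons by auto
    next
      case False
      with Cons.prems have "list_emb (\<le>) ns ms" by (intro Cons.IH) auto
      then show ?thesis by auto
    qed
  qed simp
qed simp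

section \<open>Jumps of layered permutations\<close>

lemma jumps_perm_sum_decreasing:
  assumes "0 < a" "0 < d"
  shows "jumps d (perm_sum (decreasing_perm a) xs)
    = {j. Suc j = a \<and> xs \<noteq> [] \<and> d < a + hd xs - 1} \<union> (+) a ` jumps d xs"
proof -
  have "j \<in> jumps d (perm_sum (decreasing_perm a) xs)
      \<longleftrightarrow> j \<in> {j. Suc j = a \<and> xs \<noteq> [] \<and> d < a + hd xs - 1} \<union> (+) a ` jumps d xs" for j
  proof -
    \<comment> \<open>Inside the first layer neighbours differ by 1, which is no jump as
      \<open>0 < d\<close>. At its end the entry rises from 1 to \<open>a + hd xs\<close>.
      Afterwards positions and values are both shifted by \<open>a\<close>, which preserves
      differences.\<close>
    consider "Suc j < a" | "Suc j = a" | i where "j = a + i"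
      using le_Suc_ex[of a j] by (meson Suc_lessI not_less)
    then show ?thesis
    proof cases
      case 1
      with assms show ?thesis by (auto simp: jumps_def perm_sum_def nth_append)
    next
      case 2
      with assms show ?thesis
        by (cases xs) (auto simp: jumps_def perm_sum_def nth_append)
    next
      case 3
      with assms show ?thesis
        by (auto simp: jumps_def perm_sum_def nth_append image_iff)
    qed
  qed
  then show ?thesis by blast
qed

lemma perm_sum_decreasing_0 [simp]: "perm_sum (decreasing_perm 0) xs = xs"
  by (simp add: perm_sum_def decreasing_perm_def)

lemma hd_perm_sum_decreasing: "0 < a \<Longrightarrow> hd (perm_sum (decreasing_perm a) xs) = a"
  by (simp add: perm_sum_def decreasing_perm_def)

text \<open>A large layer contributes a jump on its left and one on its right; the left one is
  accounted for in advance, which makes the induction go through.\<close>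

lemma card_jumps_layers_aux:
  assumes "0 < m"
  shows "card (jumps (2 * m) (layers ns))
      + (if layers ns \<noteq> [] \<and> m \<le> hd (layers ns) then 1 else 0)
    \<le> 2 * length (filter (\<lambda>b. m \<le> b) ns)"
proof (induction ns)
  case Nil
  show ?case by (simp add: jumps_def)
next
  case (Cons a ns)
  show ?case
  \<comment> \<open>Empty layers leave the permutation unchanged, so \<open>hd (layers ns)\<close>
    is the size of the first nonempty layer.\<close>
  proof (cases "a = 0")
    case True
    with Cons assms show ?thesis by simp
  next
    case False
    define S where "S = {j. Suc j = a \<and> layers ns \<noteq> [] \<and> 2 * m < a + hd (layers ns) - 1}"
    have S: "card S \<le> 1"
    proof -
      have "S \<subseteq> {a - 1}" by (auto simp: S_def)
      then show ?thesis using card_mono[of "{a - 1}" S] by simp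
    qed
    have jumps: "jumps (2 * m) (layers (a # ns)) = S \<union> (+) a ` jumps (2 * m) (layers ns)"
      using False assms by (simp add: jumps_perm_sum_decreasing S_def)
    have "card (jumps (2 * m) (layers (a # ns))) \<le> card S + card (jumps (2 * m) (layers ns))"
      unfolding jumps by (rule order_trans[OF card_Un_le]) (simp add: card_image)
    moreover have "hd (layers (a # ns)) = a"
      using False by (simp add: hd_perm_sum_decreasing)
    \<comment> \<open>The rise at the boundary is the sum of the two adjacent layer sizes minus 1,
      so a \<open>2 * m\<close>-jump there needs one of them to be at least \<open>m\<close>. If
      \<open>m \<le> a\<close>, the right-hand side grows by 2, paying for this jump and the new
      indicator; otherwise the indicator of the tail pays.\<close>
    moreover have "S = {}" if "a < m" "\<not> (layers ns \<noteq> [] \<and> m \<le> hd (layers ns))"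
      using that by (auto simp: S_def)
    ultimately show ?thesis
      using Cons S by (cases "m \<le> a") (auto split: if_splits)
  qed
qed

section \<open>Proper subclasses versus the whole layered class\<close>

lemma few_jumps_proper_subclass:
  assumes "perm_class C" "C \<subset> layered_class"
  shows "few_jumps C"
proof -
  obtain ns where ns: "layers ns \<notin> C"
    using assms(2) unfolding layered_class_def layered_def by blast
  \<comment> \<open>The sum bounds every entry of \<open>ns\<close>; \<open>Suc\<close> makes
    \<open>m\<close> positive, as \<open>card_jumps_layers_aux\<close> demands.\<close>
  define m where "m = Suc (sum_list ns)"
  have "card (jumps (2 * m) \<pi>) \<le> 2 * length ns" if "\<pi> \<in> C" for \<pi>
  proof -
    have "layered \<pi>" using that assms(2) by (auto simp: layered_class_def)
    then obtain ms where ms: "\<pi> = layers ms" unfolding layered_def by blast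
    have "\<not> contained_in (layers ns) (layers ms)"
      using assms(1) that ns is_perm_layers unfolding perm_class_def ms by blast
    then have "\<not> list_emb (\<le>) ns ms" using contained_in_layers by blast
    moreover have "\<forall>a \<in> set ns. a \<le> m"
      by (auto simp: m_def intro: le_SucI member_le_sum_list)
    ultimately have "length (filter (\<lambda>b. m \<le> b) ms) < length ns"
      using list_emb_of_many_large[of ns m ms] by linarith
    moreover have "card (jumps (2 * m) \<pi>) \<le> 2 * length (filter (\<lambda>b. m \<le> b) ms)"
      unfolding ms by (rule add_leD1[OF card_jumps_layers_aux]) (simp add: m_def)
    ultimately show ?thesis by linarith
  qed
  then show ?thesis unfolding few_jumps_def by blast
qed

text \<open>Among \<open>Suc M\<close> layers of size \<open>n\<close> there are \<open>M\<close>
  boundaries, and at each the entry rises by \<open>2 * n - 1\<close>, which exceeds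
  \<open>d\<close>.\<close>

lemma card_jumps_replicate:
  assumes "d < n" "0 < d"
  shows "M \<le> card (jumps d (layers (replicate (Suc M) n)))"
proof (induction M)
  case (Suc M)
  let ?xs = "layers (replicate (Suc M) n)"
  have xs: "?xs \<noteq> []" "hd ?xs = n"
    using assms by (simp_all add: hd_perm_sum_decreasing) (simp add: perm_sum_def decreasing_perm_def)
  have "jumps d (layers (replicate (Suc (Suc M)) n))
      = {j. Suc j = n \<and> ?xs \<noteq> [] \<and> d < n + hd ?xs - 1} \<union> (+) n ` jumps d ?xs"
    using assms jumps_perm_sum_decreasing[of n d ?xs] by simp
  also have "{j. Suc j = n \<and> ?xs \<noteq> [] \<and> d < n + hd ?xs - 1} = {n - 1}"
    unfolding xs(2) using xs(1) assms by auto
  finally have "card (jumps d (layers (replicate (Suc (Suc M)) n)))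
      = card ({n - 1} \<union> (+) n ` jumps d ?xs)" by simp
  also have "\<dots> = Suc (card (jumps d ?xs))"
    using assms by (subst card_Un_disjoint) (auto simp: card_image)
  finally show ?case using Suc by simp
qed simp

lemma not_few_jumps_layered_class: "\<not> few_jumps layered_class"
proof
  assume "few_jumps layered_class"
  then obtain d b where bound: "card (jumps d (layers ns)) \<le> b" for ns
    unfolding few_jumps_def layered_class_def layered_def by blast
  \<comment> \<open>The given \<open>d\<close> may be 0, so jumps are counted for the positive
    threshold \<open>Suc d\<close>, and these are also \<open>d\<close>-jumps. The
    \<open>b + 2\<close> layers have \<open>b + 1\<close> boundaries, one more than the bound
    allows.\<close>
  let ?ns = "replicate (Suc (Suc b)) (Suc (Suc d))"
  have "Suc b \<le> card (jumps (Suc d) (layers ?ns))"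
    by (rule card_jumps_replicate) auto
  also have "\<dots> \<le> card (jumps d (layers ?ns))"
    by (intro card_mono finite_jumps) (auto simp: jumps_def)
  finally show False using bound[of ?ns] by simp
qed

theorem theorem5p8:
  shows "\<not> composable layered_class"
proof
  assume "composable layered_class"
  then obtain Cs where "2 \<le> length Cs"
    and Cs: "\<forall>D \<in> set Cs. perm_class D \<and> D \<subset> layered_class"
    and sub: "layered_class \<subseteq> classes_comp Cs"
    unfolding composable_def k_composable_def by blast
  then have "Cs \<noteq> []" by auto
  have "\<forall>D \<in> set Cs. few_jumps D \<and> (\<forall>\<pi> \<in> D. is_perm \<pi>)"
  proof
    fix D assume "D \<in> set Cs"
    with Cs have "perm_class D" "D \<subset> layered_class" by blast+
    then show "few_jumps D \<and> (\<forall>\<pi> \<in> D. is_perm \<pi>)"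
      by (metis few_jumps_proper_subclass perm_class_def)
  qed
  with \<open>Cs \<noteq> []\<close> have "few_jumps (classes_comp Cs)"
    using few_jumps_classes_comp[of Cs] by simp
  then obtain d b where "\<forall>\<pi> \<in> classes_comp Cs. card (jumps d \<pi>) \<le> b"
    unfolding few_jumps_def by blast
  \<comment> \<open>A uniform bound passes to subsets, hence to all layered permutations.\<close>
  with sub have "\<forall>\<pi> \<in> layered_class. card (jumps d \<pi>) \<le> b"
    by (meson subsetD)
  then have "few_jumps layered_class" unfolding few_jumps_def by blast
  then show False using not_few_jumps_layered_class by simp
qed

end
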